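(* Let $k\ge 2$ be an integer. If both graphs $G$ and $H$ admit a neighborhood-balanced $k$-coloring, then so does the strong product $G\boxtimes H$.
   Context: All graphs are finite, simple and undirected. A neighborhood-balanced $k$-coloring of a graph is a (not necessarily proper) vertex coloring with colors $1,\dots,k$ such that every vertex has the same number of neighbors of each of the $k$ colors. The strong product $G\boxtimes H$ has vertex set $V(G)\times V(H)$, and $(u,v)$ and $(u',v')$ are adjacent if and only if ($u=u'$ and $vv'\in E(H)$), or ($v=v'$ and $uu'\in E(G)$), or ($uu'\in E(G)$ and $vv'\in E(H)$). *)

theory Defs
  imports "Graph_Theory.Pair_Digraph"
begin

text \<open>A finite simple undirected graph is a \<^locale>\<open>pair_graph\<close>: a finite vertex set with a
  symmetric, irreflexive relation \<^const>\<open>parcs\<close> on it, so that \<open>uv\<close> is an edge iff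
  \<open>(u, v) \<in> parcs G\<close>, equivalently iff \<open>(v, u) \<in> parcs G\<close>.\<close>

definition nbr :: "'a pair_pre_digraph \<Rightarrow> 'a \<Rightarrow> 'a set" where
  "nbr G v = {w. (v, w) \<in> parcs G}"

definition neighborhood_balanced_coloring ::
    "nat \<Rightarrow> 'a pair_pre_digraph \<Rightarrow> ('a \<Rightarrow> nat) \<Rightarrow> bool" where
  "neighborhood_balanced_coloring k G c \<longleftrightarrow>
     c ` pverts G \<subseteq> {1..k} \<and>
     (\<forall>v\<in>pverts G. \<forall>i\<in>{1..k}. \<forall>j\<in>{1..k}.
        card {w \<in> nbr G v. c w = i} = card {w \<in> nbr G v. c w = j})"

definition admits_neighborhood_balanced_coloring ::
    "nat \<Rightarrow> 'a pair_pre_digraph \<Rightarrow> bool" where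
  "admits_neighborhood_balanced_coloring k G \<longleftrightarrow>
     (\<exists>c. neighborhood_balanced_coloring k G c)"

definition strong_product ::
    "'a pair_pre_digraph \<Rightarrow> 'b pair_pre_digraph \<Rightarrow> ('a \<times> 'b) pair_pre_digraph"
    (infixl \<open>\<boxtimes>\<close> 70) where
  "G \<boxtimes> H =
     \<lparr> pverts = pverts G \<times> pverts H,
       parcs = {((u, v), (u', v')) | u v u' v'.
         (u, v) \<in> pverts G \<times> pverts H \<and> (u', v') \<in> pverts G \<times> pverts H \<and>
         (u = u' \<and> (v, v') \<in> parcs H \<or>
          v = v' \<and> (u, u') \<in> parcs G \<or>
          (u, u') \<in> parcs G \<and> (v, v') \<in> parcs H)} \<rparr>"

lemma pair_graph_strong_product:
  assumes "pair_graph G" and "pair_graph H"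
  shows "pair_graph (G \<boxtimes> H)"
proof -
  interpret G: pair_graph G by fact
  interpret H: pair_graph H by fact
  have sG: "(a, b) \<in> parcs G \<Longrightarrow> (b, a) \<in> parcs G" for a b
    using G.sym_arcs by (auto simp: symmetric_def sym_def)
  have sH: "(a, b) \<in> parcs H \<Longrightarrow> (b, a) \<in> parcs H" for a b
    using H.sym_arcs by (auto simp: symmetric_def sym_def)
  have lG: "(a, a) \<notin> parcs G" for a using G.no_loops' by blast
  have lH: "(a, a) \<notin> parcs H" for a using H.no_loops' by blast
  have "parcs (G \<boxtimes> H) \<subseteq> (pverts G \<times> pverts H) \<times> (pverts G \<times> pverts H)"
    by (auto simp: strong_product_def)
  then have "finite (parcs (G \<boxtimes> H))"
    by (rule finite_subset) simp
  then show ?thesis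
    by unfold_locales
      (auto simp: strong_product_def symmetric_def sym_def lG lH dest: sG sH)
qed

end

theory Submission
  imports Defs "HOL-Number_Theory.Cong"
begin

text \<open>Let \<open>c\<close> and \<open>d\<close> be neighborhood-balanced colorings of \<open>G\<close> and \<open>H\<close>, and color \<open>(u, v)\<close>
  by \<open>c u + d v\<close>, read modulo \<open>k\<close>. A coloring by residues is balanced on a finite set when all
  residue classes have the same size there. The reason the sum coloring works is that an independent
  uniform summand makes a sum uniform: if \<open>g\<close> is balanced on \<open>B\<close>, then for each fixed \<open>a\<close>
  the shifted function \<open>f a + g\<close> is still balanced on \<open>B\<close>, so \<open>f a + g b\<close> is balanced on
  \<open>A \<times> B\<close> for any \<open>f\<close> whatsoever (lemma \<open>equidistributed_add_right\<close>). The neighborhood of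
  \<open>(u, v)\<close> in the strong product splits as the disjoint union of
  \<open>({u} \<union> N(u)) \<times> N(v)\<close> and \<open>N(u) \<times> {v}\<close> (lemma \<open>nbr_strong_product\<close>). On the first
  part the balance comes from \<open>d\<close> on \<open>N(v)\<close>, on the second from \<open>c\<close> on \<open>N(u)\<close>, and a
  disjoint union of balanced sets is balanced.\<close>

text \<open>Balance is phrased with residue classes of arbitrary integers, rather than with the
  representatives \<open>1, \<dots>, k\<close>, so that it is visibly invariant under translation.\<close>

definition equidistributed_mod :: "nat \<Rightarrow> ('a \<Rightarrow> int) \<Rightarrow> 'a set \<Rightarrow> bool" where
  "equidistributed_mod k f A \<longleftrightarrow>
     (\<forall>i j. card {a \<in> A. [f a = i] (mod int k)} = card {a \<in> A. [f a = j] (mod int k)})"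

lemma equidistributed_mod_Un:
  assumes "finite A" "finite B" "A \<inter> B = {}"
    and "equidistributed_mod k f A" "equidistributed_mod k f B"
  shows "equidistributed_mod k f (A \<union> B)"
proof -
  have card_Un: "card {a \<in> A \<union> B. P a} = card {a \<in> A. P a} + card {a \<in> B. P a}" for P
  proof -
    have "{a \<in> A \<union> B. P a} = {a \<in> A. P a} \<union> {a \<in> B. P a}" by blast
    then show ?thesis
      using assms(1-3) by (simp add: card_Un_disjoint disjoint_iff)
  qed
  show ?thesis
    unfolding equidistributed_mod_def card_Un
    using assms(4,5)[unfolded equidistributed_mod_def] by (intro allI arg_cong2[of _ _ _ _ "(+)"]) blast+
qed

text \<open>The fiber of the sum over the class of \<open>i\<close>, cut at a fixed \<open>a\<close>, is the class of
  \<open>i - f a\<close> of \<open>g\<close>; its size depends on neither \<open>i\<close> nor \<open>a\<close>.\<close>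

lemma equidistributed_add_right:
  assumes "finite A" "finite B" and g: "equidistributed_mod k g B"
  shows "equidistributed_mod k (\<lambda>(a, b). f a + g b) (A \<times> B)"
proof -
  have "card {p \<in> A \<times> B. [(case p of (a, b) \<Rightarrow> f a + g b) = i] (mod int k)} =
      card A * card {b \<in> B. [g b = 0] (mod int k)}" for i
  proof -
    have "{p \<in> A \<times> B. [(case p of (a, b) \<Rightarrow> f a + g b) = i] (mod int k)} =
        (SIGMA a:A. {b \<in> B. [g b = i - f a] (mod int k)})"
      by (auto simp: cong_iff_dvd_diff algebra_simps)
    then have "card {p \<in> A \<times> B. [(case p of (a, b) \<Rightarrow> f a + g b) = i] (mod int k)} =
        (\<Sum>a\<in>A. card {b \<in> B. [g b = i - f a] (mod int k)})"
      using assms(1,2) by simp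
    also have "\<dots> = (\<Sum>a\<in>A. card {b \<in> B. [g b = 0] (mod int k)})"
      using g unfolding equidistributed_mod_def by (intro sum.cong refl) blast
    finally show ?thesis by simp
  qed
  then show ?thesis by (simp add: equidistributed_mod_def)
qed

lemma equidistributed_add_left:
  assumes "finite A" "finite B" and "equidistributed_mod k f A"
  shows "equidistributed_mod k (\<lambda>(a, b). f a + g b) (A \<times> B)"
proof -
  have "card {p \<in> A \<times> B. [(case p of (a, b) \<Rightarrow> f a + g b) = i] (mod int k)} =
      card {p \<in> B \<times> A. [(case p of (b, a) \<Rightarrow> g b + f a) = i] (mod int k)}" for i
    by (rule bij_betw_same_card[of prod.swap], rule bij_betw_byWitness[of _ prod.swap])
      (auto simp: add.commute)
  then show ?thesis
    using equidistributed_add_right[OF assms(2,1,3), of g] by (simp add: equidistributed_mod_def)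
qed

text \<open>On values in \<open>1, \<dots>, k\<close>, congruence modulo \<open>k\<close> is equality, and every residue class has a
  representative there; hence equal color classes amount to equidistribution.\<close>

lemma equidistributed_mod_of_coloring:
  fixes c :: "'a \<Rightarrow> nat"
  assumes "0 < k" and range: "c ` A \<subseteq> {1..k}"
    and eq: "\<And>i j. i \<in> {1..k} \<Longrightarrow> j \<in> {1..k} \<Longrightarrow> card {a \<in> A. c a = i} = card {a \<in> A. c a = j}"
  shows "equidistributed_mod k (\<lambda>a. int (c a)) A"
proof -
  have rep: "\<exists>m\<in>{1..k}. {a \<in> A. [int (c a) = i] (mod int k)} = {a \<in> A. c a = m}" for i
  proof -
    define m where "m = nat ((i - 1) mod int k) + 1"
    have "int m = (i - 1) mod int k + 1" and m: "m \<in> {1..k}"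
      using \<open>0 < k\<close> by (auto simp: m_def nat_less_iff Suc_le_eq)
    then have mi: "[int m = i] (mod int k)"
      by (simp add: cong_def mod_simps)
    have "[int (c a) = i] (mod int k) \<longleftrightarrow> c a = m" if "a \<in> A" for a
    proof
      assume "[int (c a) = i] (mod int k)"
      then have "int k dvd int (c a) - int m"
        using mi by (metis cong_iff_dvd_diff cong_sym cong_trans)
      moreover have "\<bar>int (c a) - int m\<bar> < int k"
        using range that m by fastforce
      ultimately show "c a = m"
        using dvd_imp_le_int[of "int (c a) - int m" "int k"] by fastforce
    qed (use mi in simp)
    then show ?thesis using m by blast
  qed
  show ?thesis
    unfolding equidistributed_mod_def
  proof (intro allI)
    fix i j
    obtain m n where "m \<in> {1..k}" "{a \<in> A. [int (c a) = i] (mod int k)} = {a \<in> A. c a = m}"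
      and "n \<in> {1..k}" "{a \<in> A. [int (c a) = j] (mod int k)} = {a \<in> A. c a = n}"
      using rep[of i] rep[of j] by blast
    then show "card {a \<in> A. [int (c a) = i] (mod int k)} = card {a \<in> A. [int (c a) = j] (mod int k)}"
      using eq[of m n] by simp
  qed
qed

lemma nbr_subset_pverts:
  assumes "pair_graph G"
  shows "nbr G v \<subseteq> pverts G"
proof -
  interpret pair_graph G by fact
  show ?thesis using in_arcsD2 by (auto simp: nbr_def)
qed

text \<open>The neighbors are grouped by their second coordinate: those that move in \<open>H\<close> may stay or
  move in \<open>G\<close>, those that rest in \<open>H\<close> must move in \<open>G\<close>. Since \<open>H\<close> has no loops,
  \<open>v \<notin> nbr H v\<close> and the two parts are disjoint.\<close>

lemma nbr_strong_product:
  assumes "pair_graph G" "pair_graph H" "u \<in> pverts G" "v \<in> pverts H"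
  shows "nbr (G \<boxtimes> H) (u, v) = insert u (nbr G u) \<times> nbr H v \<union> nbr G u \<times> {v}"
  using assms(3,4) nbr_subset_pverts[OF assms(1), of u] nbr_subset_pverts[OF assms(2), of v]
  by (auto simp: nbr_def strong_product_def)

lemma finite_nbr:
  assumes "pair_graph G"
  shows "finite (nbr G v)"
proof -
  interpret pair_graph G by fact
  show ?thesis using nbr_subset_pverts[OF assms] finite_verts by (rule finite_subset)
qed

lemma not_in_nbr_self:
  assumes "pair_graph G"
  shows "v \<notin> nbr G v"
proof -
  interpret pair_graph G by fact
  show ?thesis using no_loops' by (auto simp: nbr_def)
qed

lemma equidistributed_mod_nbr:
  assumes "pair_graph G" "0 < k" "neighborhood_balanced_coloring k G c" "v \<in> pverts G"
  shows "equidistributed_mod k (\<lambda>w. int (c w)) (nbr G v)"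
proof (rule equidistributed_mod_of_coloring)
  show "c ` nbr G v \<subseteq> {1..k}"
    using assms(3) nbr_subset_pverts[OF assms(1), of v]
    unfolding neighborhood_balanced_coloring_def by blast
  show "card {w \<in> nbr G v. c w = i} = card {w \<in> nbr G v. c w = j}"
    if "i \<in> {1..k}" "j \<in> {1..k}" for i j
    using assms(3,4) that unfolding neighborhood_balanced_coloring_def by blast
qed (fact assms(2))

theorem theorem3p5:
  fixes k :: nat
    and G :: "'a pair_pre_digraph"
    and H :: "'b pair_pre_digraph"
  assumes "k \<ge> 2"
    and "pair_graph G" and "pair_graph H"
    and "admits_neighborhood_balanced_coloring k G"
    and "admits_neighborhood_balanced_coloring k H"
  shows "admits_neighborhood_balanced_coloring k (G \<boxtimes> H)"
proof -
  obtain c d where c: "neighborhood_balanced_coloring k G c"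
    and d: "neighborhood_balanced_coloring k H d"
    using assms(4,5) by (auto simp: admits_neighborhood_balanced_coloring_def)
  have k: "0 < k" using assms(1) by simp
  define s where "s = (\<lambda>(u, v). int (c u) + int (d v))"
  \<comment> \<open>Adding 1 moves the residues \<open>0, \<dots>, k - 1\<close> into the color set \<open>1, \<dots>, k\<close>.\<close>
  define e where "e = (\<lambda>(u, v). (c u + d v) mod k + 1)"
  have e_iff: "e w = i \<longleftrightarrow> [s w = int i - 1] (mod int k)" if i: "i \<in> {1..k}" for w i
  proof -
    obtain u v where w: "w = (u, v)" by force
    have "int i - 1 = int (i - 1)" using i by auto
    then have "[s w = int i - 1] (mod int k) \<longleftrightarrow> [c u + d v = i - 1] (mod k)"
      using cong_int_iff[of "c u + d v" "i - 1" k] by (simp only: s_def w prod.case of_nat_add)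
    also have "\<dots> \<longleftrightarrow> (c u + d v) mod k = i - 1"
      using i by (auto simp: cong_def)
    also have "\<dots> \<longleftrightarrow> e w = i"
      using i by (auto simp: e_def w)
    finally show ?thesis by blast
  qed
  have balanced: "equidistributed_mod k s (nbr (G \<boxtimes> H) (u, v))"
    if uv: "u \<in> pverts G" "v \<in> pverts H" for u v
  proof -
    have "equidistributed_mod k s (insert u (nbr G u) \<times> nbr H v)"
      unfolding s_def using equidistributed_mod_nbr[OF assms(3) k d uv(2)]
      by (intro equidistributed_add_right) (auto simp: finite_nbr assms)
    moreover have "equidistributed_mod k s (nbr G u \<times> {v})"
      unfolding s_def using equidistributed_mod_nbr[OF assms(2) k c uv(1)]
      by (intro equidistributed_add_left) (auto simp: finite_nbr assms)
    ultimately show ?thesis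
      unfolding nbr_strong_product[OF assms(2,3) uv]
      by (intro equidistributed_mod_Un) (auto simp: finite_nbr not_in_nbr_self assms)
  qed
  have "card {w \<in> nbr (G \<boxtimes> H) x. e w = i} = card {w \<in> nbr (G \<boxtimes> H) x. e w = j}"
    if x: "x \<in> pverts (G \<boxtimes> H)" and i: "i \<in> {1..k}" and j: "j \<in> {1..k}" for x i j
  proof -
    obtain u v where "x = (u, v)" "u \<in> pverts G" "v \<in> pverts H"
      using x by (auto simp: strong_product_def)
    then have "equidistributed_mod k s (nbr (G \<boxtimes> H) x)" using balanced by blast
    then show ?thesis
      unfolding e_iff[OF i] e_iff[OF j] equidistributed_mod_def by blast
  qed
  moreover have "e ` pverts (G \<boxtimes> H) \<subseteq> {1..k}"
    using k by (auto simp: e_def Suc_le_eq)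
  ultimately have "neighborhood_balanced_coloring k (G \<boxtimes> H) e"
    unfolding neighborhood_balanced_coloring_def by blast
  then show ?thesis
    unfolding admits_neighborhood_balanced_coloring_def by blast
qed

end
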